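(* Let $\mathbf{X}=(X_1,\dots,X_m)^t$ be a random vector in $\mathbb{R}^m$ with a probability density $f$, and assume that $\mathbb{E}\big[\exp(\mathbf{s}^t\mathbf{X})\big]<\infty$ for every $\mathbf{s}\in\mathbb{R}^m$. For a direction (unit vector) $\boldsymbol{\theta}\in\mathbb{R}^m$, $\boldsymbol{\theta}^t\boldsymbol{\theta}=1$, let $f_{\boldsymbol{\theta}}$ denote the probability density on $\mathbb{R}$ of the projected random variable $\boldsymbol{\theta}^t\mathbf{X}$, and for a radius $r\ge 0$ let $$G_r(\boldsymbol{\theta})=\log\Big\{\mathbb{E}\big[\exp(r\,\boldsymbol{\theta}^t\mathbf{X})\big]\Big\}=\log\int_{-\infty}^{+\infty} f_{\boldsymbol{\theta}}(z)\exp(rz)\,dz .$$ Let $\boldsymbol{\theta}$ and $\boldsymbol{\theta}'$ be two directions. If there exists a real number $z^*$ such that $$f_{\boldsymbol{\theta}}(z)>f_{\boldsymbol{\theta}'}(z)\quad\text{for all } z>z^*,$$ then there exists a radius $r^*\ge 0$ such that $$G_r(\boldsymbol{\theta})>G_r(\boldsymbol{\theta}')\quad\text{for all } r>r^*.$$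
   Context: The cumulant function of a random vector $\mathbf{X}$ in $\mathbb{R}^m$ is $\mathbf{s}\mapsto\log\{\mathbb{E}[\exp(\mathbf{s}^t\mathbf{X})]\}$, $\mathbf{s}\in\mathbb{R}^m$. Writing $\mathbf{s}=r\,\boldsymbol{\theta}$ with radius $r=|\mathbf{s}|$ (the Euclidean norm) and unit direction vector $\boldsymbol{\theta}$, the value of the cumulant function at $\mathbf{s}$ is denoted $G_r(\boldsymbol{\theta})$; it is the cumulant function at $r$ of the real random variable $\boldsymbol{\theta}^t\mathbf{X}$. A direction is a unit vector of $\mathbb{R}^m$. Throughout, the cumulant function is assumed to be well defined (finite) everywhere. *)

theory Defs
  imports "HOL-Probability.Probability"
begin

definition cumulant :: "'a measure \<Rightarrow> ('a \<Rightarrow> real ^ 'm) \<Rightarrow> real ^ 'm \<Rightarrow> real" where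
  "cumulant M X s = ln (\<integral>\<omega>. exp (s \<bullet> X \<omega>) \<partial>M)"

definition G :: "'a measure \<Rightarrow> ('a \<Rightarrow> real ^ 'm) \<Rightarrow> real \<Rightarrow> real ^ 'm \<Rightarrow> real" where
  "G M X r \<theta> = cumulant M X (r *\<^sub>R \<theta>)"

lemma G_eq_ln_integral_density:
  fixes X :: "'a \<Rightarrow> real ^ 'm" and g :: "real \<Rightarrow> real"
  assumes "distributed M lborel (\<lambda>\<omega>. \<theta> \<bullet> X \<omega>) (\<lambda>z. ennreal (g z))" and "\<And>z. 0 \<le> g z"
  shows "G M X r \<theta> = ln (\<integral>z. g z * exp (r * z) \<partial>lborel)"
proof -
  have "(\<integral>z. g z * exp (r * z) \<partial>lborel) = (\<integral>\<omega>. exp (r * (\<theta> \<bullet> X \<omega>)) \<partial>M)"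
    using assms by (intro distributed_integral) auto
  then show ?thesis
    by (simp add: G_def cumulant_def)
qed

end

theory Submission imports Defs begin

text \<open>
  Let \<open>h\<close> be the difference of the two projected densities, positive beyond \<open>z0\<close>, and let
  \<open>c > 0\<close> be its integral beyond \<open>z0 + 1\<close>. Then \<open>\<integral> h(z) exp(r z) dz\<close> loses at most
  \<open>exp(r z0)\<close> on the left of \<open>z0\<close>, but gains at least \<open>c exp(r (z0 + 1))\<close> on the right of
  \<open>z0 + 1\<close>. The gain wins as soon as \<open>c exp r > 1\<close>.
\<close>

lemma eventually_exp_moment_less:
  fixes p q :: "real \<Rightarrow> real"
  assumes p: "integrable lborel p" and q: "integrable lborel q"
    and p0: "\<And>z. 0 \<le> p z" and q0: "\<And>z. 0 \<le> q z"
    and pe: "\<And>r. integrable lborel (\<lambda>z. p z * exp (r * z))"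
    and qe: "\<And>r. integrable lborel (\<lambda>z. q z * exp (r * z))"
    and less: "\<And>z. z0 < z \<Longrightarrow> q z < p z"
  shows "\<exists>r0\<ge>0. \<forall>r>r0. (\<integral>z. q z * exp (r * z) \<partial>lborel) < (\<integral>z. p z * exp (r * z) \<partial>lborel)"
proof -
  \<comment> \<open>Here the difference of \<open>p\<close> and \<open>q\<close> is already cut off
    at \<open>z0 + 1\<close>, which makes \<open>h\<close> nonnegative everywhere. The gap between
    \<open>z0\<close> and \<open>z0 + 1\<close> is what yields the factor \<open>exp r\<close>; any
    positive gap would do. The mass \<open>b\<close> stands in for 1, since \<open>q\<close> need
    not be normalised.\<close>
  define h where "h z = indicator {z0 + 1<..} z * (p z - q z)" for z
  define c where "c = (\<integral>z. h z \<partial>lborel)"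
  define b where "b = (\<integral>z. q z \<partial>lborel)"
  have hint: "integrable lborel h"
    unfolding h_def real_scaleR_def[symmetric] using p q by (intro integrable_mult_indicator) auto
  have h0: "0 \<le> h z" for z
    using less[of z] by (auto simp: h_def indicator_def)
  have b0: "0 \<le> b"
    unfolding b_def using q0 by simp
  \<comment> \<open>A nonnegative \<open>h\<close> with integral 0 vanishes almost everywhere, but
    \<open>h\<close> is positive on an interval of length 1.\<close>
  have "c \<noteq> 0"
  proof
    assume "c = 0"
    then have "AE z in lborel. h z = 0"
      using integral_nonneg_eq_0_iff_AE[OF hint] h0 by (simp add: c_def)
    then have "AE z in lborel. z \<notin> {z0 + 1<..<z0 + 2}"
    proof eventually_elim
      case (elim z)
      then show ?case
        using less[of z] by (auto simp: h_def indicator_def split: if_splits)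
    qed
    then have "emeasure lborel {z0 + 1<..<z0 + 2} = 0"
      by (subst (asm) AE_iff_measurable[where N = "{z0 + 1<..<z0 + 2}"]) auto
    then show False by simp
  qed
  moreover have "0 \<le> c"
    unfolding c_def using h0 by simp
  ultimately have c: "0 < c" by simp
  \<comment> \<open>The threshold \<open>b / c\<close> avoids a logarithm: \<open>exp r\<close>
    exceeds \<open>r\<close>, so \<open>r > b / c\<close> already forces
    \<open>c * exp r > b\<close>. It also makes \<open>r\<close> positive, so that
    \<open>exp (r * z)\<close> increases in \<open>z\<close>.\<close>
  have "(\<integral>z. q z * exp (r * z) \<partial>lborel) < (\<integral>z. p z * exp (r * z) \<partial>lborel)" if r: "b / c < r" for r
  proof -
    have r0: "0 < r"
      using r b0 c by (smt (verit) divide_nonneg_pos)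
    \<comment> \<open>The loss term is subtracted on the whole line, not only left of
      \<open>z0\<close>; this is harmless because \<open>q\<close> is nonnegative, and its integral
      is then a multiple of \<open>b\<close>. Between \<open>z0\<close> and \<open>z0 + 1\<close>
      the gain is 0, and there \<open>p\<close> exceeds \<open>q\<close>.\<close>
    have "- exp (r * z0) * q z + exp (r * (z0 + 1)) * h z \<le> p z * exp (r * z) - q z * exp (r * z)" for z
    proof (cases "z0 < z")
      case False
      then have "exp (r * z) * q z \<le> exp (r * z0) * q z"
        using r0 q0 by (intro mult_right_mono) auto
      moreover have "h z = 0"
        using False by (simp add: h_def)
      moreover have "0 \<le> p z * exp (r * z)"
        using p0 by simp
      ultimately show ?thesis by (simp add: mult.commute)
    next
      case True
      have "exp (r * (z0 + 1)) * h z \<le> exp (r * z) * (p z - q z)"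
      proof (cases "z0 + 1 < z")
        case True
        then have "exp (r * (z0 + 1)) * (p z - q z) \<le> exp (r * z) * (p z - q z)"
          using r0 less[of z] by (intro mult_right_mono) auto
        then show ?thesis
          using True by (simp add: h_def)
      next
        case False
        then show ?thesis
          using less[OF True] by (simp add: h_def)
      qed
      moreover have "0 \<le> exp (r * z0) * q z"
        using q0 by simp
      ultimately show ?thesis by (simp add: algebra_simps)
    qed
    then have "(\<integral>z. - exp (r * z0) * q z + exp (r * (z0 + 1)) * h z \<partial>lborel)
        \<le> (\<integral>z. p z * exp (r * z) - q z * exp (r * z) \<partial>lborel)"
      using q hint pe qe by (intro integral_mono) auto
    then have "exp (r * z0) * (exp r * c - b)
        \<le> (\<integral>z. p z * exp (r * z) \<partial>lborel) - (\<integral>z. q z * exp (r * z) \<partial>lborel)"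
      unfolding Bochner_Integration.integral_diff[OF pe qe]
      using q hint by (simp add: b_def c_def algebra_simps exp_add)
    moreover have "b < exp r * c"
    proof -
      have "b / c < exp r"
        using r exp_ge_add_one_self[of r] by linarith
      then show ?thesis
        using c by (simp add: field_simps)
    qed
    then have "0 < exp (r * z0) * (exp r * c - b)"
      by simp
    ultimately show ?thesis by linarith
  qed
  moreover have "0 \<le> b / c"
    using b0 c by simp
  ultimately show ?thesis by blast
qed

theorem theorem1:
  fixes M :: "'a measure"
    and X :: "'a \<Rightarrow> real ^ 'm"
    and f :: "real ^ 'm \<Rightarrow> real"
    and \<theta> \<theta>' :: "real ^ 'm"
    and f\<^sub>\<theta> f\<^sub>\<theta>' :: "real \<Rightarrow> real"
  assumes "prob_space M"
    and "\<And>x. 0 \<le> f x"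
    and "distributed M lborel X (\<lambda>x. ennreal (f x))"
    and "\<And>s. integrable M (\<lambda>\<omega>. exp (s \<bullet> X \<omega>))"
    and "\<theta> \<bullet> \<theta> = 1" and "\<theta>' \<bullet> \<theta>' = 1"
    and "\<And>z. 0 \<le> f\<^sub>\<theta> z"
    and "distributed M lborel (\<lambda>\<omega>. \<theta> \<bullet> X \<omega>) (\<lambda>z. ennreal (f\<^sub>\<theta> z))"
    and "\<And>z. 0 \<le> f\<^sub>\<theta>' z"
    and "distributed M lborel (\<lambda>\<omega>. \<theta>' \<bullet> X \<omega>) (\<lambda>z. ennreal (f\<^sub>\<theta>' z))"
    and "\<exists>z0. \<forall>z>z0. f\<^sub>\<theta> z > f\<^sub>\<theta>' z"
  shows "\<exists>r0\<ge>0. \<forall>r>r0. G M X r \<theta> > G M X r \<theta>'"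
proof -
  interpret prob_space M by fact
  \<comment> \<open>Finiteness of the moment generating function of \<open>X\<close> at
    \<open>r *\<^sub>R \<phi>\<close> is carried over to any density of the projection on
    \<open>\<phi>\<close>.\<close>
  have int_exp: "integrable lborel (\<lambda>z. g z * exp (r * z))"
    if "distributed M lborel (\<lambda>\<omega>. \<phi> \<bullet> X \<omega>) (\<lambda>z. ennreal (g z))" "\<And>z. 0 \<le> g z"
    for \<phi> g r
    using distributed_integrable[OF that(1), of "\<lambda>z. exp (r * z)"] that(2) assms(4)[of "r *\<^sub>R \<phi>"]
    by simp
  obtain z0 where "\<And>z. z0 < z \<Longrightarrow> f\<^sub>\<theta>' z < f\<^sub>\<theta> z"
    using assms(11) by blast
  \<comment> \<open>The instances of \<open>int_exp\<close> at radius 0 give integrability of the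
    densities themselves.\<close>
  then obtain r0 where r0: "0 \<le> r0" and less: "\<And>r. r0 < r \<Longrightarrow>
      (\<integral>z. f\<^sub>\<theta>' z * exp (r * z) \<partial>lborel) < (\<integral>z. f\<^sub>\<theta> z * exp (r * z) \<partial>lborel)"
    using eventually_exp_moment_less[of f\<^sub>\<theta> f\<^sub>\<theta>' z0] assms(7,9)
      int_exp[OF assms(8,7), of 0] int_exp[OF assms(10,9), of 0]
      int_exp[OF assms(8,7)] int_exp[OF assms(10,9)]
    by auto
  \<comment> \<open>\<open>ln\<close> is strictly increasing only on positive arguments, so the
    smaller integral must be shown positive. It is the expectation of a positive variable.\<close>
  have pos: "0 < (\<integral>z. f\<^sub>\<theta>' z * exp (r * z) \<partial>lborel)" for r
  proof -
    have "(\<integral>z. f\<^sub>\<theta>' z * exp (r * z) \<partial>lborel) = expectation (\<lambda>\<omega>. exp (r * (\<theta>' \<bullet> X \<omega>)))"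
      using assms(9,10) by (intro distributed_integral) auto
    moreover have "0 < expectation (\<lambda>\<omega>. exp (r * (\<theta>' \<bullet> X \<omega>)))"
      using assms(4)[of "r *\<^sub>R \<theta>'"] by (intro expectation_greater) auto
    ultimately show ?thesis by simp
  qed
  have "G M X r \<theta>' < G M X r \<theta>" if "r0 < r" for r
    unfolding G_eq_ln_integral_density[OF assms(8,7)] G_eq_ln_integral_density[OF assms(10,9)]
    using less[OF that] pos[of r] by simp
  with r0 show ?thesis by blast
qed

end
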